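(* Let $I\subset\mathbb{R}$ be an interval, let $p\in\mathbb{R}\setminus\{0\}$, let $\alpha>0$, let $u:I\to\mathbb{R}$ be hyperbolic $p$-convex on $I$, and let $a,b\in I$ with $a<b$. Let $v:I\to\mathbb{R}$ be a function which on $[a,b]$ is positive, symmetric (that is, $v(a+b-x)=v(x)$ for $x\in[a,b]$) and integrable. Then $$I^\alpha_{a+}[uv](b)+I^\alpha_{b-}[uv](a)\;\leq\;\frac{u(a)+u(b)}{2}\cdot\frac{1}{\cosh\left(\frac{p(b-a)}{2}\right)}\,\mathcal{C}^1_\alpha(v)+\frac{u(a)-u(b)}{2}\cdot\frac{1}{\sinh\left(\frac{p(b-a)}{2}\right)}\,\mathcal{S}^1_\alpha(v),$$ where $$\mathcal{C}^1_{\alpha}(v):=\int_a^b\cosh\left[p\left(x-\frac{a+b}{2}\right)\right]\frac{(b-x)^{\alpha-1}+(x-a)^{\alpha-1}}{\Gamma(\alpha)}\,v(x)\,dx,$$ $$\mathcal{S}^1_\alpha(v):=\int_a^b\sinh\left[p\left(x-\frac{a+b}{2}\right)\right]\frac{(b-x)^{\alpha-1}+(x-a)^{\alpha-1}}{\Gamma(\alpha)}\,v(x)\,dx.$$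
   Context: A function $f:I\to\mathbb{R}$ is hyperbolic $p$-convex on $I$ if for every closed subinterval $[a,b]\subset I$ (with $a<b$) and all $x\in[a,b]$, $$f(x)\leq \frac{\sinh[p(b-x)]}{\sinh[p(b-a)]}f(a)+\frac{\sinh[p(x-a)]}{\sinh[p(b-a)]}f(b).$$ The Riemann--Liouville fractional integrals of order $\alpha>0$ are $I^\alpha_{a+}[f](t)=\frac{1}{\Gamma(\alpha)}\int_a^t(t-s)^{\alpha-1}f(s)\,ds$ for $t\in(a,b]$ and $I^\alpha_{b-}[f](t)=\frac{1}{\Gamma(\alpha)}\int_t^b(s-t)^{\alpha-1}f(s)\,ds$ for $t\in[a,b)$, where $\Gamma$ is the Euler gamma function; $uv$ denotes the pointwise product.
   Formalization: For α<1 it is also assumed that (b-x)^{α-1}v(x) is integrable on [a,b]; for merely Lebesgue integrable v this can fail, and then C^1_α(v) is infinite and S^1_α(v) is undefined. It is automatic for bounded v. *)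

theory Defs
  imports "HOL-Analysis.Analysis"
begin

definition hyperbolic_p_convex_on :: "real \<Rightarrow> real set \<Rightarrow> (real \<Rightarrow> real) \<Rightarrow> bool" where
  "hyperbolic_p_convex_on p I f \<longleftrightarrow>
     (\<forall>a b. a < b \<longrightarrow> {a..b} \<subseteq> I \<longrightarrow>
       (\<forall>x\<in>{a..b}. f x \<le> sinh (p * (b - x)) / sinh (p * (b - a)) * f a
                        + sinh (p * (x - a)) / sinh (p * (b - a)) * f b))"

text \<open>
  All integrals are Lebesgue integrals.  At the singular endpoint of a kernel with
  exponent \<open>\<alpha> - 1 \<le> 0\<close> the convention \<open>0 powr r = 0\<close> only affects a null set.
  As usual in HOL, an integral whose integrand is not integrable has the value 0.
\<close>

definition rl_integral_left :: "real \<Rightarrow> real \<Rightarrow> (real \<Rightarrow> real) \<Rightarrow> real \<Rightarrow> real" where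
  "rl_integral_left \<alpha> a f t =
     1 / Gamma \<alpha> * (LINT s:{a..t}|lebesgue. (t - s) powr (\<alpha> - 1) * f s)"

definition rl_integral_right :: "real \<Rightarrow> real \<Rightarrow> (real \<Rightarrow> real) \<Rightarrow> real \<Rightarrow> real" where
  "rl_integral_right \<alpha> b f t =
     1 / Gamma \<alpha> * (LINT s:{t..b}|lebesgue. (s - t) powr (\<alpha> - 1) * f s)"

definition C1 :: "real \<Rightarrow> real \<Rightarrow> real \<Rightarrow> real \<Rightarrow> (real \<Rightarrow> real) \<Rightarrow> real" where
  "C1 p \<alpha> a b v =
     (LINT x:{a..b}|lebesgue. cosh (p * (x - (a + b) / 2))
        * (((b - x) powr (\<alpha> - 1) + (x - a) powr (\<alpha> - 1)) / Gamma \<alpha>) * v x)"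

definition S1 :: "real \<Rightarrow> real \<Rightarrow> real \<Rightarrow> real \<Rightarrow> (real \<Rightarrow> real) \<Rightarrow> real" where
  "S1 p \<alpha> a b v =
     (LINT x:{a..b}|lebesgue. sinh (p * (x - (a + b) / 2))
        * (((b - x) powr (\<alpha> - 1) + (x - a) powr (\<alpha> - 1)) / Gamma \<alpha>) * v x)"

text \<open>
  For \<open>\<alpha> < 1\<close> the kernel is unbounded, and integrability of a positive symmetric \<open>v\<close> does
  not make the integrals in the inequality finite.  The theorem therefore assumes in that
  case, and only then, that the integral defining \<open>rl_integral_left \<alpha> a v b\<close> exists (by symmetry
  of \<open>v\<close>, so does the one defining \<open>rl_integral_right \<alpha> b v a\<close>).  This is equivalent to
  the existence of the integral \<open>C1 p \<alpha> a b v\<close>, and nothing is assumed about the integrability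
  of \<open>u\<close> or of the product of \<open>u\<close> and \<open>v\<close>.
\<close>

end

theory Submission imports Defs begin

text \<open>
  Write \<open>m = (a + b) / 2\<close> and let \<open>W x\<close> be \<open>v x\<close> times the sum of the two kernels. This weight is
  nonnegative and symmetric about \<open>m\<close>, and the left-hand side is \<open>1 / Gamma \<alpha>\<close> times the integral of
  \<open>u W\<close>. By the symmetry of \<open>W\<close>, that integral does not change if \<open>u x\<close> is replaced by the mean of
  \<open>u x\<close> and \<open>u (a + b - x)\<close>. Adding the defining inequality at \<open>x\<close> and at \<open>a + b - x\<close> bounds this
  mean by \<open>(u a + u b) / 2 * cosh (p (x - m)) / cosh (p (b - a) / 2)\<close>
  (\<open>hyperbolic_p_convex_on_reflected_sum\<close>), and integrating against \<open>W\<close> gives the term in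
  \<open>C1\<close>. The integrand of \<open>S1\<close> is odd about \<open>m\<close>, so the term in \<open>S1\<close> vanishes.

  What remains is the integrability of \<open>u W\<close>: without it the integral on the left would take
  a default value and monotonicity would be unavailable. Since \<open>W\<close> is integrable, it is enough that
  \<open>u\<close> be bounded and measurable on \<open>[a, b]\<close>. The lower bound comes from the reflected inequality
  at the midpoint. For measurability, \<open>y = exp (2 p x)\<close> turns the hyperbolic chords into
  straight lines: the function \<open>x \<mapsto> exp (p x) u x\<close> is an ordinary convex function of \<open>y\<close>, and is
  therefore continuous in the interior.
\<close>

section \<open>Hyperbolic convexity\<close>

lemma hyperbolic_p_convex_on_subset:
  "hyperbolic_p_convex_on p I f \<Longrightarrow> J \<subseteq> I \<Longrightarrow> hyperbolic_p_convex_on p J f"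
  unfolding hyperbolic_p_convex_on_def by blast

text \<open>The quotients of hyperbolic sines are even in \<open>p\<close>, which allows arguments with \<open>p > 0\<close>.\<close>

lemma hyperbolic_p_convex_on_abs:
  "hyperbolic_p_convex_on \<bar>p\<bar> I f \<longleftrightarrow> hyperbolic_p_convex_on p I f"
  by (cases "p \<ge> 0") (simp_all add: hyperbolic_p_convex_on_def)

text \<open>
  The two coefficients of the chord at \<open>x\<close> are exchanged by the reflection, and their sum is a
  quotient of hyperbolic cosines by the sum and double-angle formulas for \<open>sinh\<close>.
\<close>

lemma hyperbolic_p_convex_on_reflected_sum:
  fixes p c d x :: real
  assumes conv: "hyperbolic_p_convex_on p {c..d} u" and "p \<noteq> 0" "c < d" "x \<in> {c..d}"
  shows "u x + u (c + d - x) \<le> (u c + u d) * (cosh (p * (x - (c + d) / 2)) / cosh (p * (d - c) / 2))"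
proof -
  define h where "h = p * (d - c) / 2"
  define z where "z = p * (x - (c + d) / 2)"
  have h: "sinh h \<noteq> 0" "cosh h > 0"
    using assms by (auto simp: h_def)
  have arg: "p * (d - x) = h - z" "p * (x - c) = h + z" "p * (d - c) = 2 * h"
    by (simp_all add: h_def z_def field_simps)
  have refl: "d - (c + d - x) = x - c" "c + d - x - c = d - x" by auto
  have chord: "u y \<le> sinh (p * (d - y)) / sinh (p * (d - c)) * u c
                        + sinh (p * (y - c)) / sinh (p * (d - c)) * u d" if "y \<in> {c..d}" for y
    using conv that \<open>c < d\<close> unfolding hyperbolic_p_convex_on_def by blast
  have "u x + u (c + d - x)
      \<le> (sinh (h - z) / sinh (2 * h) * u c + sinh (h + z) / sinh (2 * h) * u d)
        + (sinh (h + z) / sinh (2 * h) * u c + sinh (h - z) / sinh (2 * h) * u d)"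
    using chord[of x] chord[of "c + d - x"] assms(4) unfolding arg refl by (intro add_mono) auto
  also have "\<dots> = (u c + u d) * ((sinh (h - z) + sinh (h + z)) / sinh (2 * h))"
    by (simp add: algebra_simps add_divide_distrib)
  also have "(sinh (h - z) + sinh (h + z)) / sinh (2 * h) = cosh z / cosh h"
    using h unfolding sinh_add sinh_diff sinh_double by (simp add: field_simps)
  finally show ?thesis by (simp add: h_def z_def)
qed

text \<open>
  On \<open>[a, b]\<close> the chord bounds \<open>u\<close> above. The reflected inequality at the midpoint \<open>m\<close> of \<open>[a, b]\<close>,
  on the interval with endpoints \<open>x\<close> and \<open>a + b - x\<close>, then gives a lower bound of \<open>u x\<close> in terms of
  \<open>u m\<close> and the upper bound of \<open>u (a + b - x)\<close>.
\<close>

lemma hyperbolic_p_convex_on_bounded: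
  fixes p a b :: real
  assumes conv: "hyperbolic_p_convex_on p {a..b} u" and "p > 0" "a < b"
  shows "bounded (u ` {a..b})"
proof -
  define M where "M = \<bar>u a\<bar> + \<bar>u b\<bar>"
  define m where "m = (a + b) / 2"
  define N where "N = 2 * cosh (p * (b - a) / 2) * \<bar>u m\<bar> + M"
  have upper: "u x \<le> M" if x: "x \<in> {a..b}" for x
  proof -
    define q where "q y = sinh (p * y) / sinh (p * (b - a))" for y
    have q: "q y * r \<le> \<bar>r\<bar>" if "0 \<le> y" "y \<le> b - a" for y r
    proof -
      have "0 \<le> q y" "q y \<le> 1"
        using that assms by (auto simp: q_def)
      then have "\<bar>q y * r\<bar> \<le> \<bar>r\<bar>"
        by (simp add: abs_mult mult_left_le_one_le)
      then show ?thesis by linarith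
    qed
    have "u x \<le> q (b - x) * u a + q (x - a) * u b"
      using conv x \<open>a < b\<close> unfolding hyperbolic_p_convex_on_def q_def by blast
    also have "\<dots> \<le> M"
      unfolding M_def using x by (intro add_mono q) auto
    finally show ?thesis .
  qed
  have midpoint: "2 * (cosh (p * (d - c) / 2) * u m) \<le> u c + u d"
    if "c + d = a + b" "a \<le> c" "c < d" "d \<le> b" for c d
  proof -
    have "hyperbolic_p_convex_on p {c..d} u"
      using hyperbolic_p_convex_on_subset[OF conv] that by auto
    from hyperbolic_p_convex_on_reflected_sum[OF this, of m]
    have "u m + u (c + d - m) \<le> (u c + u d) / cosh (p * (d - c) / 2)"
      using that assms by (simp add: m_def)
    moreover have "c + d - m = m"
      using that by (simp add: m_def field_simps)
    ultimately have "2 * u m \<le> (u c + u d) / cosh (p * (d - c) / 2)"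
      by simp
    then show ?thesis
      by (simp add: pos_le_divide_eq algebra_simps)
  qed
  have cosh_bound: "- (cosh (p * (b - a) / 2) * \<bar>u m\<bar>) \<le> cosh (p * (d - c) / 2) * u m"
    if "c \<le> d" "d - c \<le> b - a" for c d
  proof -
    have "cosh (p * (d - c) / 2) \<le> cosh (p * (b - a) / 2)"
      using that assms by (subst cosh_real_nonneg_le_iff) auto
    then have "\<bar>cosh (p * (d - c) / 2) * u m\<bar> \<le> cosh (p * (b - a) / 2) * \<bar>u m\<bar>"
      by (simp add: abs_mult mult_right_mono)
    then show ?thesis by linarith
  qed
  have lower: "- N \<le> u x" if x: "x \<in> {a..b}" for x
  proof -
    \<comment> \<open>At \<open>x = m\<close> the interval between \<open>x\<close> and \<open>a + b - x\<close> degenerates; there \<open>cosh \<ge> 1\<close> suffices.\<close>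
    consider "x < a + b - x" | "x = m" | "a + b - x < x"
      unfolding m_def by force
    then show ?thesis
    proof cases
      case 1
      then show ?thesis
        using midpoint[of x "a + b - x"] cosh_bound[of x "a + b - x"] upper[of "a + b - x"] x
        by (auto simp: N_def)
    next
      case 2
      have "\<bar>u m\<bar> \<le> cosh (p * (b - a) / 2) * \<bar>u m\<bar>" "0 \<le> M"
        using mult_right_mono[OF cosh_real_ge_1[of "p * (b - a) / 2"], of "\<bar>u m\<bar>"]
        by (auto simp: M_def)
      then show ?thesis using 2 by (auto simp: N_def)
    next
      case 3
      then show ?thesis
        using midpoint[of "a + b - x" x] cosh_bound[of "a + b - x" x] upper[of "a + b - x"] x
        by (auto simp: N_def)
    qed
  qed
  have "M \<le> N" by (simp add: N_def)
  then have "\<bar>u x\<bar> \<le> N" if "x \<in> {a..b}" for x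
    using upper[OF that] lower[OF that] by linarith
  then show ?thesis
    by (auto simp: bounded_iff intro!: exI[of _ N])
qed

text \<open>
  With \<open>y = exp (2 p x)\<close> one has
  \<open>sinh (p (d - x)) / sinh (p (d - c)) = exp (p c) / exp (p x) * (y\<^sub>d - y) / (y\<^sub>d - y\<^sub>c)\<close>, so
  the hyperbolic chord of \<open>u\<close> is, up to the factor \<open>exp (p x)\<close>, an affine function of \<open>y\<close>.
\<close>

lemma sinh_quotient_conv_exp:
  fixes p r s t :: real
  assumes "p * s \<noteq> p * t"
  shows "sinh (p * (r - s)) / sinh (p * (t - s))
       = exp (p * t) / exp (p * r) * ((exp (2 * p * r) - exp (2 * p * s)) / (exp (2 * p * t) - exp (2 * p * s)))"
proof -
  have sq: "exp (2 * p * x) = exp (p * x) ^ 2" for x :: real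
    by (simp add: mult.assoc exp_double)
  have sinh_diff_conv: "sinh (p * (x - s)) = (exp (p * x) ^ 2 - exp (p * s) ^ 2) / (2 * exp (p * x) * exp (p * s))"
    for x :: real
  proof -
    have "sinh (p * (x - s)) = (exp (p * x) / exp (p * s) - exp (p * s) / exp (p * x)) / 2"
      by (simp add: sinh_field_def right_diff_distrib flip: exp_diff)
    then show ?thesis by (simp add: field_simps power2_eq_square)
  qed
  have "exp (p * t) ^ 2 \<noteq> exp (p * s) ^ 2"
    using assms unfolding sq[symmetric] by auto
  then show ?thesis
    unfolding sinh_diff_conv sq by (simp add: field_simps)
qed

lemma hyperbolic_p_convex_on_imp_convex_on:
  fixes p a b :: real
  assumes conv: "hyperbolic_p_convex_on p {a..b} u" and "p > 0"
  shows "convex_on {exp (2 * p * a)<..<exp (2 * p * b)} (\<lambda>y. sqrt y * u (ln y / (2 * p)))"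
proof (rule convex_on_linorderI)
  fix t x y :: real
  let ?S = "{exp (2 * p * a)<..<exp (2 * p * b)}"
  assume t: "0 < t" "t < 1" and xy: "x \<in> ?S" "y \<in> ?S" "x < y"
  define l where "l z = ln z / (2 * p)" for z
  define z where "z = (1 - t) * x + t * y"
  have diffs: "z - x = t * (y - x)" "y - z = (1 - t) * (y - x)"
    by (simp_all add: z_def algebra_simps)
  then have t_conv: "t = (z - x) / (y - x)" "1 - t = (y - z) / (y - x)"
    using xy by simp_all
  have "0 < t * (y - x)" "0 < (1 - t) * (y - x)"
    using t xy by simp_all
  then have z: "x < z" "z < y"
    unfolding diffs[symmetric] by simp_all
  have pos: "0 < x" "0 < y" "0 < z"
    using xy z less_trans[OF exp_gt_zero, of "2 * p * a" x] by auto
  have exp_l: "exp (2 * p * l w) = w" "exp (p * l w) = sqrt w" if "0 < w" for w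
  proof -
    show "exp (2 * p * l w) = w"
      using that \<open>p > 0\<close> by (simp add: l_def)
    have "p * l w = ln (sqrt w)"
      using that \<open>p > 0\<close> by (simp add: l_def ln_sqrt)
    then show "exp (p * l w) = sqrt w"
      using that by simp
  qed
  have l_mono: "l v < l w" if "0 < v" "v < w" for v w
    using that \<open>p > 0\<close> by (simp add: l_def divide_strict_right_mono)
  have "2 * p * a < ln x" "ln y < 2 * p * b"
    using xy pos ln_less_cancel_iff[of "exp (2 * p * a)" x] ln_less_cancel_iff[of y "exp (2 * p * b)"]
    by simp_all
  then have l_bounds: "a \<le> l x" "l y \<le> b"
    using \<open>p > 0\<close> by (simp_all add: l_def field_simps)
  have "u (l z) \<le> sinh (p * (l y - l z)) / sinh (p * (l y - l x)) * u (l x)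
                + sinh (p * (l z - l x)) / sinh (p * (l y - l x)) * u (l y)"
    using conv l_bounds l_mono[of x y] l_mono[of x z] l_mono[of z y] pos z
    unfolding hyperbolic_p_convex_on_def by auto
  also have "sinh (p * (l y - l z)) / sinh (p * (l y - l x)) = sinh (p * (l z - l y)) / sinh (p * (l x - l y))"
    using sinh_minus[of "p * (l y - l z)"] sinh_minus[of "p * (l y - l x)"]
    by (simp flip: mult_minus_right)
  also have "\<dots> = sqrt x / sqrt z * (1 - t)"
    using sinh_quotient_conv_exp[of p "l y" "l x" "l z"] l_mono[of x y] pos z \<open>p > 0\<close>
      minus_divide_divide[of "z - y" "x - y"]
    by (simp add: exp_l t_conv(2))
  also have "sinh (p * (l z - l x)) / sinh (p * (l y - l x)) = sqrt y / sqrt z * t"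
    using sinh_quotient_conv_exp[of p "l x" "l y" "l z"] l_mono[of x y] pos z \<open>p > 0\<close>
    by (simp add: exp_l t_conv(1))
  finally have "sqrt z * u (l z) \<le> sqrt z * (sqrt x / sqrt z * (1 - t) * u (l x) + sqrt y / sqrt z * t * u (l y))"
    using pos by (intro mult_left_mono) auto
  also have "\<dots> = (1 - t) * (sqrt x * u (l x)) + t * (sqrt y * u (l y))"
    using pos by (simp add: field_simps)
  finally show "sqrt ((1 - t) *\<^sub>R x + t *\<^sub>R y) * u (ln ((1 - t) *\<^sub>R x + t *\<^sub>R y) / (2 * p))
      \<le> (1 - t) * (sqrt x * u (ln x / (2 * p))) + t * (sqrt y * u (ln y / (2 * p)))"
    by (simp add: z_def l_def)
qed (rule convex_real_interval)

lemma hyperbolic_p_convex_on_continuous: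
  fixes p a b :: real
  assumes conv: "hyperbolic_p_convex_on p {a..b} u" and "p > 0"
  shows "continuous_on {a<..<b} u"
proof -
  let ?S = "{exp (2 * p * a)<..<exp (2 * p * b)}"
  let ?g = "\<lambda>y. sqrt y * u (ln y / (2 * p))"
  have "continuous_on ?S ?g"
    by (intro convex_on_continuous hyperbolic_p_convex_on_imp_convex_on assms open_greaterThanLessThan)
  then have "continuous_on {a<..<b} (\<lambda>x. ?g (exp (2 * p * x)))"
    by (rule continuous_on_compose2) (use \<open>p > 0\<close> in \<open>auto intro!: continuous_intros\<close>)
  then have "continuous_on {a<..<b} (\<lambda>x. ?g (exp (2 * p * x)) / sqrt (exp (2 * p * x)))"
    by (rule continuous_on_divide) (auto intro!: continuous_intros)
  moreover have "?g (exp (2 * p * x)) / sqrt (exp (2 * p * x)) = u x" for x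
    using \<open>p > 0\<close> by simp
  ultimately show ?thesis
    by (simp only:)
qed

text \<open>At the endpoints \<open>u\<close> may jump upwards, so their values are added separately.\<close>

lemma hyperbolic_p_convex_on_measurable:
  fixes p a b :: real
  assumes conv: "hyperbolic_p_convex_on p {a..b} u" and "p > 0" "a < b"
  shows "u \<in> borel_measurable (lebesgue_on {a..b})"
proof -
  let ?f = "\<lambda>x. if x \<in> {a<..<b} then u x else 0"
  have "u \<in> borel_measurable (lebesgue_on {a<..<b})"
    using hyperbolic_p_convex_on_continuous[OF conv \<open>p > 0\<close>]
    by (intro continuous_imp_measurable_on_sets_lebesgue) auto
  then have "?f \<in> borel_measurable lebesgue"
    by (intro borel_measurable_if_I) auto
  then have "(\<lambda>x. ?f x + u a * indicator {a} x + u b * indicator {b} x) \<in> borel_measurable lebesgue"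
    by (intro borel_measurable_add borel_measurable_times borel_measurable_const borel_measurable_indicator) auto
  then have "(\<lambda>x. ?f x + u a * indicator {a} x + u b * indicator {b} x)
      \<in> borel_measurable (lebesgue_on {a..b})"
    by (rule measurable_restrict_space1)
  then show ?thesis
    by (rule measurable_cong[THEN iffD1, rotated]) (use \<open>a < b\<close> in \<open>auto simp: indicator_def\<close>)
qed

section \<open>Reflection of integrals\<close>

lemma
  fixes f :: "real \<Rightarrow> real"
  assumes "f absolutely_integrable_on {a..b}"
  shows absolutely_integrable_reflect_interval: "(\<lambda>x. f (a + b - x)) absolutely_integrable_on {a..b}"
    and LINT_reflect_interval: "(LINT x:{a..b}|lebesgue. f (a + b - x)) = (LINT x:{a..b}|lebesgue. f x)"
proof -
  have image: "(\<lambda>x. a + b - x) ` {a..b} = {a..b}"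
    by simp
  have "(\<lambda>x. \<bar>-1\<bar> * f (a + b - x)) absolutely_integrable_on {a..b} \<and>
      integral {a..b} (\<lambda>x. \<bar>-1\<bar> * f (a + b - x)) = integral {a..b} f \<longleftrightarrow>
      f absolutely_integrable_on ((\<lambda>x. a + b - x) ` {a..b}) \<and>
      integral ((\<lambda>x. a + b - x) ` {a..b}) f = integral {a..b} f"
    by (rule has_absolute_integral_change_of_variables_1') (auto intro!: derivative_eq_intros inj_onI)
  then have *: "(\<lambda>x. f (a + b - x)) absolutely_integrable_on {a..b} \<and>
      integral {a..b} (\<lambda>x. f (a + b - x)) = integral {a..b} f"
    using assms unfolding image by simp
  then show "(\<lambda>x. f (a + b - x)) absolutely_integrable_on {a..b}" by blast
  then show "(LINT x:{a..b}|lebesgue. f (a + b - x)) = (LINT x:{a..b}|lebesgue. f x)"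
    using assms * by (simp add: set_lebesgue_integral_eq_integral)
qed

lemma absolutely_integrable_continuous_mult:
  fixes f g :: "real \<Rightarrow> real"
  assumes "continuous_on {a..b} f" "g absolutely_integrable_on {a..b}"
  shows "(\<lambda>x. f x * g x) absolutely_integrable_on {a..b}"
proof (rule absolutely_integrable_bounded_measurable_product_real)
  show "f \<in> borel_measurable (lebesgue_on {a..b})"
    using assms(1) by (intro continuous_imp_measurable_on_sets_lebesgue) auto
  show "bounded (f ` {a..b})"
    using assms(1) by (intro compact_imp_bounded compact_continuous_image) auto
qed (use assms in auto)

text \<open>For \<open>\<alpha> \<ge> 1\<close> the kernel is bounded, so it preserves integrability.\<close>

lemma absolutely_integrable_kernel_mult:
  fixes \<alpha> :: real
  assumes "\<alpha> \<ge> 1" "v absolutely_integrable_on {a..b}"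
  shows "(\<lambda>x. (b - x) powr (\<alpha> - 1) * v x) absolutely_integrable_on {a..b}"
proof (rule absolutely_integrable_bounded_measurable_product_real)
  have "(\<lambda>x. (b - x) powr (\<alpha> - 1)) \<in> borel_measurable borel" by measurable
  then show "(\<lambda>x. (b - x) powr (\<alpha> - 1)) \<in> borel_measurable (lebesgue_on {a..b})"
    by (intro measurable_restrict_space1 measurable_completion) (simp add: lborel_def)
  show "bounded ((\<lambda>x. (b - x) powr (\<alpha> - 1)) ` {a..b})"
    using assms(1) by (auto simp: bounded_iff intro!: exI[of _ "(b - a) powr (\<alpha> - 1)"] powr_mono2)
qed (use assms in auto)

section \<open>The inequality\<close>

text \<open>
  A Fejer type inequality for a general symmetric weight: symmetrising \<open>u\<close> under the integral
  reduces it to the pointwise bound for \<open>u x + u (a + b - x)\<close>.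
\<close>

lemma hyperbolic_p_convex_on_weighted_integral:
  fixes p a b :: real and u W :: "real \<Rightarrow> real"
  assumes conv: "hyperbolic_p_convex_on p {a..b} u" and "p \<noteq> 0" "a < b"
    and W: "W absolutely_integrable_on {a..b}"
    and uW: "(\<lambda>x. u x * W x) absolutely_integrable_on {a..b}"
    and nonneg: "\<And>x. x \<in> {a..b} \<Longrightarrow> 0 \<le> W x"
    and sym: "\<And>x. x \<in> {a..b} \<Longrightarrow> W (a + b - x) = W x"
  shows "(LINT x:{a..b}|lebesgue. u x * W x)
    \<le> (u a + u b) / 2 * (1 / cosh (p * (b - a) / 2))
      * (LINT x:{a..b}|lebesgue. cosh (p * (x - (a + b) / 2)) * W x)"
proof -
  let ?I = "\<lambda>f. LINT x:{a..b}|lebesgue. f x"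
  let ?k = "(u a + u b) / cosh (p * (b - a) / 2)"
  have uW': "(\<lambda>x. u (a + b - x) * W (a + b - x)) absolutely_integrable_on {a..b}"
    by (rule absolutely_integrable_reflect_interval[OF uW])
  have coshW: "(\<lambda>x. cosh (p * (x - (a + b) / 2)) * W x) absolutely_integrable_on {a..b}"
    by (intro absolutely_integrable_continuous_mult W continuous_intros)
  have "2 * ?I (\<lambda>x. u x * W x) = ?I (\<lambda>x. u x * W x) + ?I (\<lambda>x. u (a + b - x) * W (a + b - x))"
    by (simp add: LINT_reflect_interval[OF uW])
  also have "\<dots> = ?I (\<lambda>x. u x * W x + u (a + b - x) * W (a + b - x))"
    by (rule set_integral_add(2)[OF uW uW', symmetric])
  also have "\<dots> \<le> ?I (\<lambda>x. ?k * (cosh (p * (x - (a + b) / 2)) * W x))"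
  proof (rule set_integral_mono)
    fix x assume x: "x \<in> {a..b}"
    have "(u x + u (a + b - x)) * W x
        \<le> (u a + u b) * (cosh (p * (x - (a + b) / 2)) / cosh (p * (b - a) / 2)) * W x"
      using x by (intro mult_right_mono hyperbolic_p_convex_on_reflected_sum assms nonneg)
    then show "u x * W x + u (a + b - x) * W (a + b - x)
        \<le> ?k * (cosh (p * (x - (a + b) / 2)) * W x)"
      using sym[OF x] by (simp add: algebra_simps)
  qed (intro set_integral_add set_integrable_mult_right uW uW' coshW)+
  also have "\<dots> = ?k * ?I (\<lambda>x. cosh (p * (x - (a + b) / 2)) * W x)"
    by (rule set_integral_mult_right)
  finally show ?thesis by simp
qed

lemma LINT_sinh_symmetric_weight_eq_0:
  fixes p a b :: real and W :: "real \<Rightarrow> real"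
  assumes W: "W absolutely_integrable_on {a..b}"
    and sym: "\<And>x. x \<in> {a..b} \<Longrightarrow> W (a + b - x) = W x"
  shows "(LINT x:{a..b}|lebesgue. sinh (p * (x - (a + b) / 2)) * W x) = 0"
proof -
  let ?f = "\<lambda>x. sinh (p * (x - (a + b) / 2)) * W x"
  have "?f absolutely_integrable_on {a..b}"
    by (intro absolutely_integrable_continuous_mult W continuous_intros)
  then have "(LINT x:{a..b}|lebesgue. ?f x) = (LINT x:{a..b}|lebesgue. ?f (a + b - x))"
    by (rule LINT_reflect_interval[symmetric])
  also have "\<dots> = (LINT x:{a..b}|lebesgue. - ?f x)"
  proof (rule set_lebesgue_integral_cong)
    have "p * (a + b - x - (a + b) / 2) = - (p * (x - (a + b) / 2))" for x
      by (simp add: field_simps)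
    then show "\<forall>x. x \<in> {a..b} \<longrightarrow> ?f (a + b - x) = - ?f x"
      using sym by (metis sinh_minus mult_minus_left)
  qed auto
  also have "\<dots> = - (LINT x:{a..b}|lebesgue. ?f x)"
    by (simp add: set_lebesgue_integral_def)
  finally show ?thesis by simp
qed

theorem theorem2p5:
  fixes I :: "real set" and p \<alpha> a b :: real and u v :: "real \<Rightarrow> real"
  assumes "is_interval I"
    and "p \<noteq> 0"
    and "\<alpha> > 0"
    and "hyperbolic_p_convex_on p I u"
    and "a \<in> I" and "b \<in> I" and "a < b"
    and "\<forall>x\<in>{a..b}. 0 < v x"
    and "\<forall>x\<in>{a..b}. v (a + b - x) = v x"
    and "v absolutely_integrable_on {a..b}"
    and "\<alpha> < 1 \<longrightarrow> (\<lambda>x. (b - x) powr (\<alpha> - 1) * v x) absolutely_integrable_on {a..b}"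
  shows "rl_integral_left \<alpha> a (\<lambda>x. u x * v x) b + rl_integral_right \<alpha> b (\<lambda>x. u x * v x) a
    \<le> (u a + u b) / 2 * (1 / cosh (p * (b - a) / 2)) * C1 p \<alpha> a b v
      + (u a - u b) / 2 * (1 / sinh (p * (b - a) / 2)) * S1 p \<alpha> a b v"
proof -
  let ?I = "\<lambda>f. LINT x:{a..b}|lebesgue. f x"
  define A where "A x = (b - x) powr (\<alpha> - 1) * v x" for x
  define B where "B x = (x - a) powr (\<alpha> - 1) * v x" for x
  define W where "W x = A x + B x" for x
  have Gamma: "Gamma \<alpha> > 0"
    using \<open>\<alpha> > 0\<close> by (rule Gamma_real_pos)
  have "{a..b} \<subseteq> I"
    using assms(1,5,6) by (metis atLeastAtMost_iff mem_is_interval_1_I subsetI)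
  then have conv: "hyperbolic_p_convex_on p {a..b} u"
    by (rule hyperbolic_p_convex_on_subset[OF assms(4)])
  have conv_abs: "hyperbolic_p_convex_on \<bar>p\<bar> {a..b} u" "\<bar>p\<bar> > 0"
    using conv \<open>p \<noteq> 0\<close> by (simp_all add: hyperbolic_p_convex_on_abs)

  have A: "A absolutely_integrable_on {a..b}"
    unfolding A_def using absolutely_integrable_kernel_mult[of \<alpha> a b v] assms(10,11) by linarith
  have reflect: "A (a + b - x) = B x" "B (a + b - x) = A x" if "x \<in> {a..b}" for x
    using assms(9) that by (simp_all add: A_def B_def)
  have B: "B absolutely_integrable_on {a..b}"
    using absolutely_integrable_reflect_interval[OF A] reflect(1)
    by (subst set_integrable_cong[OF refl refl, of _ _ "\<lambda>x. A (a + b - x)"]) auto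
  have W: "W absolutely_integrable_on {a..b}"
    unfolding W_def by (intro set_integral_add A B)
  have W_sym: "W (a + b - x) = W x" if "x \<in> {a..b}" for x
    using reflect[OF that] by (simp add: W_def)
  have W_nonneg: "0 \<le> W x" if "x \<in> {a..b}" for x
  proof -
    have "0 \<le> v x"
      using assms(8) that by (intro less_imp_le) blast
    then show ?thesis by (simp add: W_def A_def B_def)
  qed

  have u_mult: "(\<lambda>x. u x * f x) absolutely_integrable_on {a..b}"
    if "f absolutely_integrable_on {a..b}" for f
    using hyperbolic_p_convex_on_measurable[OF conv_abs \<open>a < b\<close>]
      hyperbolic_p_convex_on_bounded[OF conv_abs \<open>a < b\<close>] that
    by (intro absolutely_integrable_bounded_measurable_product_real) auto

  have "rl_integral_left \<alpha> a (\<lambda>x. u x * v x) b + rl_integral_right \<alpha> b (\<lambda>x. u x * v x) a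
      = 1 / Gamma \<alpha> * (?I (\<lambda>x. u x * A x) + ?I (\<lambda>x. u x * B x))"
    by (simp add: rl_integral_left_def rl_integral_right_def A_def B_def distrib_left mult.left_commute)
  also have "\<dots> = 1 / Gamma \<alpha> * ?I (\<lambda>x. u x * W x)"
    using u_mult[OF A] u_mult[OF B] by (simp add: W_def distrib_left)
  also have "\<dots> \<le> 1 / Gamma \<alpha> * ((u a + u b) / 2 * (1 / cosh (p * (b - a) / 2))
      * ?I (\<lambda>x. cosh (p * (x - (a + b) / 2)) * W x))"
    using Gamma
    by (intro mult_left_mono hyperbolic_p_convex_on_weighted_integral
          conv W u_mult W_nonneg W_sym \<open>p \<noteq> 0\<close> \<open>a < b\<close>) auto
  also have "\<dots> = (u a + u b) / 2 * (1 / cosh (p * (b - a) / 2)) * C1 p \<alpha> a b v"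
  proof -
    have "cosh (p * (x - (a + b) / 2)) * (((b - x) powr (\<alpha> - 1) + (x - a) powr (\<alpha> - 1)) / Gamma \<alpha>) * v x
        = 1 / Gamma \<alpha> * (cosh (p * (x - (a + b) / 2)) * W x)" for x
      by (simp add: W_def A_def B_def algebra_simps add_divide_distrib)
    then have "C1 p \<alpha> a b v = 1 / Gamma \<alpha> * ?I (\<lambda>x. cosh (p * (x - (a + b) / 2)) * W x)"
      unfolding C1_def by (simp only: set_integral_mult_right)
    then show ?thesis by simp
  qed
  moreover have "S1 p \<alpha> a b v = 0"
  proof -
    have "sinh (p * (x - (a + b) / 2)) * (((b - x) powr (\<alpha> - 1) + (x - a) powr (\<alpha> - 1)) / Gamma \<alpha>) * v x
        = 1 / Gamma \<alpha> * (sinh (p * (x - (a + b) / 2)) * W x)" for x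
      by (simp add: W_def A_def B_def algebra_simps add_divide_distrib)
    then have "S1 p \<alpha> a b v = 1 / Gamma \<alpha> * ?I (\<lambda>x. sinh (p * (x - (a + b) / 2)) * W x)"
      unfolding S1_def by (simp only: set_integral_mult_right)
    then show ?thesis
      using LINT_sinh_symmetric_weight_eq_0[OF W W_sym] by simp
  qed
  ultimately show ?thesis by simp
qed

end
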